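(* Let $\mathbb{F}$ be a field with $\operatorname{char}(\mathbb{F}) \neq 0$. Then there is a family $(f_n)_{n \in \mathbb{N}}$, where $f_n \in \mathbb{F}[x_1,\ldots,x_n]$ is a homogeneous polynomial of some degree $d=d_n$, such that for every function $k = k(n)$ with $k(n) = o(n)$ and all sufficiently large $n$ the following holds: for all $m_1,\ldots,m_k \in \mathbb{N}$, all linear $L_j^{(i)} \in \mathbb{F}[x_1,\ldots,x_n]$ ($1 \le i \le k$, $1 \le j \le m_i$) and all constants $c_1,\ldots,c_k \in \mathbb{F}$, $$f_n \neq \sum_{i=1}^{k} c_i\, e_{d}^{m_i}\bigl(L_1^{(i)},\ldots,L_{m_i}^{(i)}\bigr).$$ Further, this holds in the border setting: for all linear $L_j^{(i)} \in \mathbb{F}(\epsilon)[x_1,\ldots,x_n]$ and all $c_1,\ldots,c_k \in \mathbb{F}(\epsilon)$, the polynomial $\sum_{i=1}^{k} c_i\, e_{d}^{m_i}(L_1^{(i)},\ldots,L_{m_i}^{(i)})$ is not of the form $\epsilon^N f_n + \epsilon^{N+1} Q$ with $N \ge 0$ an integer and $Q \in \mathbb{F}[x_1,\ldots,x_n,\epsilon]$.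
   Context: $e_d^m(y_1,\ldots,y_m) = \sum_{S \subseteq [m],\, |S|=d} \prod_{i \in S} y_i$ is the elementary symmetric polynomial of degree $d$ in $m$ variables (zero if $m<d$). "Linear" polynomials are homogeneous linear forms, i.e. with zero constant term. $\epsilon$ is a new variable and $\mathbb{F}(\epsilon)$ is the field of rational functions in $\epsilon$. *)

theory Defs
  imports
    "HOL-Library.Poly_Mapping"
    "HOL-Library.Landau_Symbols"
    "HOL-Computational_Algebra.Computational_Algebra"
begin

text \<open>A monomial is a finitely supported exponent map on variable indices,
  a polynomial a finitely supported coefficient map on monomials.\<close>

type_synonym 'a mpoly = "(nat \<Rightarrow>\<^sub>0 nat) \<Rightarrow>\<^sub>0 'a"

text \<open>The polynomials that involve only the variables with indices \<open>1, \<dots>, n\<close>.\<close>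

definition mpolys :: "nat \<Rightarrow> 'a::zero mpoly set" where
  "mpolys n = {p. \<forall>t\<in>Poly_Mapping.keys p. Poly_Mapping.keys t \<subseteq> {1..n}}"

definition monom_degree :: "(nat \<Rightarrow>\<^sub>0 nat) \<Rightarrow> nat" where
  "monom_degree t = (\<Sum>i\<in>Poly_Mapping.keys t. Poly_Mapping.lookup t i)"

text \<open>The zero polynomial is homogeneous of every degree; in particular it is a linear form.\<close>

definition homogeneous :: "nat \<Rightarrow> 'a::zero mpoly \<Rightarrow> bool" where
  "homogeneous d p \<longleftrightarrow> (\<forall>t\<in>Poly_Mapping.keys p. monom_degree t = d)"

definition linear_forms :: "nat \<Rightarrow> 'a::zero mpoly set" where
  "linear_forms n = {p \<in> mpolys n. homogeneous 1 p}"

definition mconst :: "'a::zero \<Rightarrow> 'a mpoly" where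
  "mconst c = Poly_Mapping.single 0 c"

definition esym :: "nat \<Rightarrow> nat \<Rightarrow> (nat \<Rightarrow> 'b::comm_semiring_1) \<Rightarrow> 'b" where
  "esym d m y = (\<Sum>S | S \<subseteq> {1..m} \<and> card S = d. \<Prod>i\<in>S. y i)"

text \<open>The field \<open>F(\<epsilon>)\<close> is \<^typ>\<open>'a poly fract\<close>, and \<open>F[x, \<epsilon>]\<close> is
  represented as \<open>F[\<epsilon>][x]\<close>, that is by \<^typ>\<open>'a poly mpoly\<close>.\<close>

definition eps :: "'a::field poly fract" where
  "eps = to_fract [:0, 1:]"

definition lift_const :: "'a::field mpoly \<Rightarrow> 'a poly fract mpoly" where
  "lift_const = Poly_Mapping.map (\<lambda>a. to_fract [:a:])"

definition lift_poly :: "'a::field poly mpoly \<Rightarrow> 'a poly fract mpoly" where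
  "lift_poly = Poly_Mapping.map to_fract"

end

theory Submission
  imports Defs
begin

text \<open>
  Let \<open>p\<close> be the characteristic, \<open>d = p + 1\<close>, and let \<open>f\<^sub>n\<close> be the sum of
  \<open>s = n div (p + 1)\<close> products of \<open>p + 1\<close> variables, over pairwise disjoint blocks of
  variables. A partial derivative of \<open>e\<^sub>d(L\<^sub>1, \<dots>, L\<^sub>m)\<close> is a combination of the
  \<open>e\<^sub>p\<close> of the forms other than \<open>L\<^sub>i\<close>, and modulo \<open>e\<^sub>1, \<dots>, e\<^sub>p\<close> of all the forms
  that polynomial is congruent to \<open>(- L\<^sub>i) ^ p\<close>, a combination of \<open>p\<close>-th powers of variables.
  Hence the derivatives of a sum of \<open>k\<close> such terms lie in an ideal with \<open>k * p\<close> generators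
  without constant term, modulo the ideal \<open>J\<close> of polynomials without squarefree monomials.

  Take the derivative of \<open>f\<^sub>n\<close> with respect to the first variable of each block. The result is
  the product of the other \<open>p\<close> variables, and only \<open>(2 ^ p - 1) ^ s\<close> of the \<open>2 ^ (p * s)\<close>
  squarefree monomials in these variables are divisible by none of the products. As every generator
  has its \<open>p\<close>-th power in \<open>J\<close>, adjoining it lowers the dimension of the quotient at most by the
  factor \<open>p\<close>. So \<open>2 ^ (p * s) \<le> p ^ (k * p) * (2 ^ p - 1) ^ s\<close>, which bounds \<open>k\<close> from below by
  a multiple of \<open>n\<close>. In the border setting the products are perturbed by multiples of \<open>\<epsilon>\<close>, and
  Nakayama's argument over the local ring at \<open>\<epsilon> = 0\<close> shows that the same monomials still span
  the quotient.
\<close>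

section \<open>Derivatives and elementary symmetric polynomials\<close>

abbreviation "lookup \<equiv> Poly_Mapping.lookup"
abbreviation "keys \<equiv> Poly_Mapping.keys"
abbreviation "single \<equiv> Poly_Mapping.single"

lemma poly_mapping_sum_monomials: "p = (\<Sum>t\<in>keys p. single t (lookup p t))"
  by (rule poly_mapping_eqI)
     (auto simp: lookup_sum lookup_single when_def sum.delta' in_keys_iff)

lemma mpoly_induct [case_names add single]:
  assumes "\<And>p q. P p \<Longrightarrow> P q \<Longrightarrow> P (p + q)" and "\<And>t c. P (single t c)"
  shows "P (p :: 'a::comm_monoid_add mpoly)"
proof -
  have "P (\<Sum>t\<in>A. single t (lookup p t))" if "finite A" for A
    using that
  proof induction
    case empty
    show ?case using assms(2)[of 0 0] by simp
  qed (simp add: assms)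
  from this[OF finite_keys] show ?thesis
    using poly_mapping_sum_monomials[of p] by metis
qed

section \<open>Formal partial derivatives of polynomials and the product rule\<close>

definition pdiff :: "nat \<Rightarrow> 'a::comm_semiring_1 mpoly \<Rightarrow> 'a mpoly" where
  "pdiff v p = (\<Sum>t\<in>keys p. single (t - single v 1) (of_nat (lookup t v) * lookup p t))"

lemma lookup_pdiff:
  "lookup (pdiff v p) t = of_nat (lookup t v + 1) * lookup p (t + single v 1)"
proof -
  have "lookup (pdiff v p) t =
      (\<Sum>u\<in>keys p. if u = t + single v 1 then of_nat (lookup u v) * lookup p u else 0)"
    unfolding pdiff_def lookup_sum
  proof (rule sum.cong[OF refl])
    fix u
    \<comment> \<open>Subtraction of exponents is truncated, so shifting back recovers
      \<open>u\<close> only if \<open>v\<close> occurs in it; otherwise the factor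
      \<open>of_nat (lookup u v)\<close> is zero.\<close>
    have "u - single v 1 = t \<longleftrightarrow> u = t + single v 1" if "lookup u v \<noteq> 0"
    proof
      assume "u - single v 1 = t"
      moreover have "u = (u - single v 1) + single v 1"
        using that by (intro poly_mapping_eqI) (auto simp: lookup_add lookup_minus lookup_single when_def)
      ultimately show "u = t + single v 1" by simp
    qed simp
    then show "lookup (single (u - single v 1) (of_nat (lookup u v) * lookup p u)) t =
        (if u = t + single v 1 then of_nat (lookup u v) * lookup p u else 0)"
      by (cases "lookup u v = 0") (auto simp: lookup_single when_def)
  qed
  also have "\<dots> = of_nat (lookup t v + 1) * lookup p (t + single v 1)"
    by (auto simp: sum.delta lookup_add in_keys_iff)
  finally show ?thesis .
qed

lemma pdiff_add: "pdiff v (p + q) = pdiff v p + pdiff v q"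
  by (rule poly_mapping_eqI) (simp add: lookup_pdiff lookup_add algebra_simps)

lemma pdiff_zero [simp]: "pdiff v 0 = 0"
  by (simp add: pdiff_def)

lemma pdiff_single: "pdiff v (single t c) = single (t - single v 1) (of_nat (lookup t v) * c)"
  by (cases "c = 0") (simp_all add: pdiff_def)

lemma pdiff_sum: "pdiff v (sum f A) = (\<Sum>x\<in>A. pdiff v (f x))"
  by (induction A rule: infinite_finite_induct) (simp_all add: pdiff_add)

text \<open>Both sides are biadditive, so two monomials suffice. If one of them lacks
  \<open>v\<close>, truncated subtraction may give a wrong exponent, but the coefficient of that
  summand is zero.\<close>

lemma pdiff_mult: "pdiff v (p * q) = pdiff v p * q + p * pdiff v q"
proof (induction p rule: mpoly_induct)
  case (single s a)
  show ?case
  proof (induction q rule: mpoly_induct)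
    case (single t b)
    have 1: "s + t - single v 1 = (s - single v 1) + t" if "lookup s v \<noteq> 0"
      using that by (intro poly_mapping_eqI) (auto simp: lookup_add lookup_minus lookup_single when_def)
    have 2: "s + t - single v 1 = s + (t - single v 1)" if "lookup t v \<noteq> 0"
      using that by (intro poly_mapping_eqI) (auto simp: lookup_add lookup_minus lookup_single when_def)
    have "pdiff v (single s a * single t b) =
        single (s + t - single v 1) (of_nat (lookup s v) * a * b) +
        single (s + t - single v 1) (of_nat (lookup t v) * a * b)"
      by (simp add: mult_single pdiff_single lookup_add algebra_simps flip: single_add)
    also have "single (s + t - single v 1) (of_nat (lookup s v) * a * b) = pdiff v (single s a) * single t b"
      using 1 by (cases "lookup s v = 0") (simp_all add: pdiff_single mult_single)
    also have "single (s + t - single v 1) (of_nat (lookup t v) * a * b) = single s a * pdiff v (single t b)"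
      using 2 by (cases "lookup t v = 0") (simp_all add: pdiff_single mult_single algebra_simps)
    finally show ?case .
  qed (simp add: pdiff_add algebra_simps)
qed (simp add: pdiff_add algebra_simps)

lemma pdiff_mconst_mult: "pdiff v (mconst c * p) = mconst c * pdiff v p"
  by (simp add: pdiff_mult mconst_def pdiff_single)

lemma pdiff_prod:
  assumes "finite S"
  shows "pdiff v (prod y S) = (\<Sum>i\<in>S. pdiff v (y i) * prod y (S - {i}))"
  using assms
proof induction
  case empty
  show ?case using pdiff_single[of v 0 1] by simp
next
  case (insert j S)
  have "(\<Sum>i\<in>S. pdiff v (y i) * prod y (insert j S - {i})) =
      (\<Sum>i\<in>S. y j * (pdiff v (y i) * prod y (S - {i})))"
    using insert.hyps
    by (intro sum.cong refl)
       (auto simp: insert_Diff_if algebra_simps)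
  then show ?case
    using insert by (simp add: pdiff_mult sum_distrib_left)
qed

section \<open>Elementary symmetric polynomials over an arbitrary finite index set\<close>

definition esym_on :: "nat \<Rightarrow> nat set \<Rightarrow> (nat \<Rightarrow> 'b::comm_semiring_1) \<Rightarrow> 'b" where
  "esym_on d I y = (\<Sum>S | S \<subseteq> I \<and> card S = d. \<Prod>i\<in>S. y i)"

lemma esym_conv_esym_on: "esym d m y = esym_on d {1..m} y"
  by (simp add: esym_def esym_on_def)

lemma esym_on_0 [simp]: "finite I \<Longrightarrow> esym_on 0 I y = 1"
proof -
  assume "finite I"
  then have "{S. S \<subseteq> I \<and> card S = 0} = {{}}"
    by (auto dest: finite_subset)
  then show ?thesis by (simp add: esym_on_def)
qed

text \<open>Removing and reinserting \<open>i\<close> is the bijection behind both the recursion for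
  \<open>esym_on\<close> and its derivative.\<close>

lemma subsets_containing:
  assumes "finite I" "i \<in> I"
  shows "{S. S \<subseteq> I \<and> card S = Suc q \<and> i \<in> S} = insert i ` {S. S \<subseteq> I - {i} \<and> card S = q}"
    (is "?L = insert i ` ?R")
proof
  show "?L \<subseteq> insert i ` ?R"
  proof
    fix S assume "S \<in> ?L"
    then have "S - {i} \<in> ?R" "insert i (S - {i}) = S"
      using assms by (auto simp: card_Diff_singleton)
    then show "S \<in> insert i ` ?R" by blast
  qed
  show "insert i ` ?R \<subseteq> ?L"
  proof clarify
    fix S assume "S \<subseteq> I - {i}" "q = card S"
    moreover from this have "finite S" "i \<notin> S" using assms by (auto intro: finite_subset)
    ultimately show "insert i S \<subseteq> I \<and> card (insert i S) = Suc (card S) \<and> i \<in> insert i S"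
      using assms by auto
  qed
qed

lemma inj_on_insert_Diff: "inj_on (insert i) {S. S \<subseteq> I - {i} \<and> card S = q}"
  by (rule inj_onI) blast

text \<open>Splits the index sets by whether they contain \<open>i\<close>.\<close>

lemma esym_on_Suc_remove:
  assumes "finite I" "i \<in> I"
  shows "esym_on (Suc q) I y = esym_on (Suc q) (I - {i}) y + y i * esym_on q (I - {i}) y"
proof -
  let ?A = "{S. S \<subseteq> I - {i} \<and> card S = Suc q}" and ?B = "{S. S \<subseteq> I - {i} \<and> card S = q}"
  have "{S. S \<subseteq> I \<and> card S = Suc q} = ?A \<union> {S. S \<subseteq> I \<and> card S = Suc q \<and> i \<in> S}"
    by blast
  then have "{S. S \<subseteq> I \<and> card S = Suc q} = ?A \<union> insert i ` ?B"
    by (simp only: subsets_containing[OF assms])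
  moreover have "finite ?A" "finite ?B" "?A \<inter> insert i ` ?B = {}"
    using assms by auto
  ultimately have "esym_on (Suc q) I y = sum (prod y) ?A + (\<Sum>S\<in>?B. prod y (insert i S))"
    by (simp add: esym_on_def sum.union_disjoint sum.reindex[OF inj_on_insert_Diff])
  also have "(\<Sum>S\<in>?B. prod y (insert i S)) = (\<Sum>S\<in>?B. y i * prod y S)"
  proof (rule sum.cong[OF refl])
    fix S assume "S \<in> ?B"
    then have "finite S" "i \<notin> S" using assms by (auto intro: finite_subset)
    then show "prod y (insert i S) = y i * prod y S" by simp
  qed
  finally show ?thesis
    by (simp add: esym_on_def sum_distrib_left)
qed

text \<open>After the product rule the two summations are swapped: for fixed \<open>i\<close>, the
  sets containing \<open>i\<close> become, without \<open>i\<close>, all \<open>q\<close>-element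
  subsets of \<open>I - {i}\<close>.\<close>

lemma pdiff_esym_on:
  assumes "finite I"
  shows "pdiff v (esym_on (Suc q) I y) = (\<Sum>i\<in>I. pdiff v (y i) * esym_on q (I - {i}) y)"
proof -
  let ?A = "{S. S \<subseteq> I \<and> card S = Suc q}"
  have "pdiff v (esym_on (Suc q) I y) = (\<Sum>S\<in>?A. \<Sum>i\<in>S. pdiff v (y i) * prod y (S - {i}))"
    unfolding esym_on_def pdiff_sum
    using assms by (intro sum.cong refl pdiff_prod) (auto dest: finite_subset)
  also have "\<dots> = (\<Sum>S\<in>?A. \<Sum>i\<in>I. if i \<in> S then pdiff v (y i) * prod y (S - {i}) else 0)"
  proof (rule sum.cong[OF refl])
    fix S assume "S \<in> ?A"
    then show "(\<Sum>i\<in>S. pdiff v (y i) * prod y (S - {i})) =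
        (\<Sum>i\<in>I. if i \<in> S then pdiff v (y i) * prod y (S - {i}) else 0)"
      using assms by (simp add: Int_absorb1 flip: sum.inter_restrict)
  qed
  also have "\<dots> = (\<Sum>i\<in>I. \<Sum>S\<in>?A. if i \<in> S then pdiff v (y i) * prod y (S - {i}) else 0)"
    by (rule sum.swap)
  also have "\<dots> = (\<Sum>i\<in>I. pdiff v (y i) * esym_on q (I - {i}) y)"
  proof (rule sum.cong[OF refl])
    fix i assume "i \<in> I"
    have "(\<Sum>S\<in>?A. if i \<in> S then pdiff v (y i) * prod y (S - {i}) else 0) =
        (\<Sum>S | S \<subseteq> I \<and> card S = Suc q \<and> i \<in> S. pdiff v (y i) * prod y (S - {i}))"
      using assms by (simp add: sum.If_cases Int_def conj_assoc)
    also have "\<dots> = (\<Sum>S | S \<subseteq> I - {i} \<and> card S = q. pdiff v (y i) * prod y S)"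
      unfolding subsets_containing[OF assms \<open>i \<in> I\<close>]
      by (subst sum.reindex[OF inj_on_insert_Diff]) (auto intro!: sum.cong simp: Diff_insert_absorb subset_Diff_insert)
    finally show "(\<Sum>S\<in>?A. if i \<in> S then pdiff v (y i) * prod y (S - {i}) else 0) =
        pdiff v (y i) * esym_on q (I - {i}) y"
      by (simp add: esym_on_def sum_distrib_left)
  qed
  finally show ?thesis .
qed

section \<open>Ideals as submodules, and polynomials as a vector space\<close>

global_interpretation ideal: module "(*) :: 'a::comm_ring_1 \<Rightarrow> 'a \<Rightarrow> 'a"
  by unfold_locales (simp_all add: algebra_simps)

text \<open>As a rewrite rule this is associativity from right to left, which loops with
  \<open>algebra_simps\<close>.\<close>

declare ideal.scale_scale [simp del]

text \<open>Modulo \<open>Z\<close> the recursion for removing \<open>i\<close> says that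
  \<open>esym_on (Suc q) (I - {i}) y\<close> is \<open>- y i * esym_on q (I - {i}) y\<close>.
  Starting from degree 0, this turns each factor \<open>esym_on p (I - {i}) y\<close> of the
  derivative into \<open>(- y i) ^ p\<close>, which lies in \<open>Z\<close>.\<close>

lemma pdiff_esym_on_mem_ideal:
  fixes y :: "nat \<Rightarrow> 'a::comm_ring_1 mpoly"
  assumes "finite I" "ideal.subspace Z"
    and Z: "\<And>q. 1 \<le> q \<Longrightarrow> q \<le> p \<Longrightarrow> esym_on q I y \<in> Z"
    and pow: "\<And>i. i \<in> I \<Longrightarrow> y i ^ p \<in> Z"
  shows "pdiff v (esym_on (Suc p) I y) \<in> Z"
proof -
  have rem: "esym_on q (I - {i}) y - (- y i) ^ q \<in> Z" if "i \<in> I" "q \<le> p" for i q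
    using that(2)
  proof (induction q)
    case 0
    show ?case using assms by (simp add: ideal.subspace_0)
  next
    case (Suc q)
    have "esym_on (Suc q) (I - {i}) y - (- y i) ^ Suc q =
        esym_on (Suc q) I y - y i * (esym_on q (I - {i}) y - (- y i) ^ q)"
      using esym_on_Suc_remove[OF assms(1) that(1), of q y] by (simp add: algebra_simps)
    also have "\<dots> \<in> Z"
      using Suc by (intro ideal.subspace_diff[OF assms(2)] ideal.subspace_scale[OF assms(2)] Z Suc.IH) simp_all
    finally show ?case .
  qed
  have "esym_on p (I - {i}) y \<in> Z" if "i \<in> I" for i
  proof -
    have "(- y i) ^ p = (- 1) ^ p * y i ^ p" by (rule power_minus)
    also have "\<dots> \<in> Z" using that by (intro ideal.subspace_scale[OF assms(2)] pow)
    finally show ?thesis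
      using ideal.subspace_add[OF assms(2) rem[OF that order.refl], of "(- y i) ^ p"] by (simp only: diff_add_cancel)
  qed
  then show ?thesis
    unfolding pdiff_esym_on[OF assms(1)]
    by (intro ideal.subspace_sum[OF assms(2)] ideal.subspace_scale[OF assms(2)])
qed

text \<open>Dimensions are counted over the field, while ideals allow multiplication by all
  polynomials; this second scalar action keeps \<open>mpoly.span\<close> apart from
  \<open>ideal.span\<close>.\<close>

definition msmult :: "'a::field \<Rightarrow> 'a mpoly \<Rightarrow> 'a mpoly" where
  "msmult c p = mconst c * p"

global_interpretation mpoly: vector_space "msmult :: 'a::field \<Rightarrow> _"
proof unfold_locales
  fix a b :: 'a and x y :: "'a mpoly"
  show "msmult a (x + y) = msmult a x + msmult a y"
    by (simp add: msmult_def algebra_simps)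
  show "msmult (a + b) x = msmult a x + msmult b x"
    by (simp add: msmult_def mconst_def single_add algebra_simps)
  show "msmult a (msmult b x) = msmult (a * b) x"
    by (simp add: msmult_def mconst_def mult_single flip: mult.assoc)
  show "msmult 1 x = x"
    by (simp add: msmult_def mconst_def)
qed

section \<open>Dimension counting modulo nilpotent generators\<close>

lemma lookup_msmult: "lookup (msmult c q) t = c * lookup q t"
proof (induction q rule: mpoly_induct)
  case (single s b)
  then show ?case by (simp add: msmult_def mconst_def mult_single lookup_single when_def)
qed (simp add: mpoly.scale_right_distrib lookup_add algebra_simps)

lemma mpoly_mult_mem_span:
  assumes "u \<in> mpoly.span U"
  shows "c * u \<in> mpoly.span ((*) c ` U)"
  using assms
proof (induction rule: mpoly.span_induct_alt)
  case base
  show ?case by (simp add: mpoly.span_zero)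
next
  case (step a x y)
  have "c * (msmult a x + y) = msmult a (c * x) + c * y"
    by (simp add: msmult_def algebra_simps)
  moreover have "c * x \<in> (*) c ` U" using step(1) by blast
  ultimately show ?case
    using step by (simp only: mpoly.span_add mpoly.span_scale mpoly.span_base)
qed

text \<open>Expanding the cofactor of \<open>g\<close> repeatedly by \<open>gen\<close> gives a
  combination of elements \<open>g ^ i * u\<close> with \<open>i < p\<close> and \<open>u\<close> in
  \<open>U\<close>, up to a multiple of \<open>g ^ p\<close>, which lies in
  \<open>J\<close>.\<close>

lemma spanning_mod_remove_generator:
  fixes g :: "'a::field mpoly"
  assumes J: "ideal.subspace J" "g ^ p \<in> J" and "finite U"
    and gen: "\<And>a. \<exists>u\<in>mpoly.span U. \<exists>h. a - u - g * h \<in> J"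
  shows "\<exists>U'. finite U' \<and> card U' \<le> p * card U \<and> (\<forall>a. \<exists>u\<in>mpoly.span U'. a - u \<in> J)"
proof -
  define V where "V j = (\<Union>i<j. (*) (g ^ i) ` U)" for j :: nat
  have V_Suc: "V (Suc j) = V j \<union> (*) (g ^ j) ` U" for j
    unfolding V_def lessThan_Suc by blast
  have claim: "\<exists>u\<in>mpoly.span (V j). \<exists>h. a - u - g ^ j * h \<in> J" for a j
  proof (induction j)
    case 0
    show ?case
      by (intro bexI[of _ 0] exI[of _ a]) (simp_all add: ideal.subspace_0 J mpoly.span_zero)
  next
    case (Suc j)
    then obtain u h where u: "u \<in> mpoly.span (V j)" "a - u - g ^ j * h \<in> J"
      by blast
    obtain w h' where w: "w \<in> mpoly.span U" "h - w - g * h' \<in> J"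
      using gen by blast
    have "u \<in> mpoly.span (V (Suc j))"
      using u(1) by (rule subsetD[OF mpoly.span_mono, rotated]) (simp add: V_Suc)
    moreover have "g ^ j * w \<in> mpoly.span (V (Suc j))"
      using mpoly_mult_mem_span[OF w(1)]
      by (rule subsetD[OF mpoly.span_mono, rotated]) (simp add: V_Suc)
    ultimately have "u + g ^ j * w \<in> mpoly.span (V (Suc j))"
      by (rule mpoly.span_add)
    moreover have "a - (u + g ^ j * w) - g ^ Suc j * h' =
        (a - u - g ^ j * h) + g ^ j * (h - w - g * h')"
      by (simp add: algebra_simps)
    then have "a - (u + g ^ j * w) - g ^ Suc j * h' \<in> J"
      using ideal.subspace_add[OF J(1) u(2) ideal.subspace_scale[OF J(1) w(2)]] by (simp only:)
    ultimately show ?case by blast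
  qed
  have "\<exists>u\<in>mpoly.span (V p). a - u \<in> J" for a
  proof -
    obtain u h where u: "u \<in> mpoly.span (V p)" "a - u - g ^ p * h \<in> J"
      using claim by blast
    have "(a - u - g ^ p * h) + h * g ^ p \<in> J"
      by (rule ideal.subspace_add[OF J(1) u(2) ideal.subspace_scale[OF J]])
    then have "a - u \<in> J"
      by (simp only: mult.commute[of h] diff_add_cancel)
    with u(1) show ?thesis by blast
  qed
  moreover have "finite (V p)"
    using \<open>finite U\<close> by (simp add: V_def)
  moreover have "card (V p) \<le> p * card U"
  proof -
    have "card (V p) \<le> (\<Sum>i<p. card ((*) (g ^ i) ` U))"
      unfolding V_def by (rule card_UN_le) simp
    also have "\<dots> \<le> (\<Sum>i<p. card U)"
      by (intro sum_mono card_image_le assms)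
    finally show ?thesis by simp
  qed
  ultimately show ?thesis by blast
qed

text \<open>Induction on \<open>G\<close> with \<open>J\<close> arbitrary: the induction hypothesis,
  applied to \<open>J\<close> enlarged by \<open>g\<close>, removes the other generators, and then
  \<open>g\<close> is removed by the preceding lemma. Each removal contributes one factor
  \<open>p\<close>.\<close>

lemma spanning_mod_remove_generators:
  fixes G :: "'a::field mpoly set"
  assumes "finite G" "ideal.subspace J" "\<And>g. g \<in> G \<Longrightarrow> g ^ p \<in> J" "finite U"
    and "\<And>a. \<exists>u\<in>mpoly.span U. a - u \<in> ideal.span (G \<union> J)"
  shows "\<exists>U'. finite U' \<and> card U' \<le> p ^ card G * card U \<and> (\<forall>a. \<exists>u\<in>mpoly.span U'. a - u \<in> J)"
  using assms
proof (induction G arbitrary: J rule: finite_induct)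
  case empty
  then have "ideal.span J = J" by simp
  with empty show ?case by (intro exI[of _ U]) simp
next
  case (insert g G)
  define J' where "J' = ideal.span (insert g J)"
  have "ideal.subspace J'" by (simp add: J'_def)
  moreover have "h ^ p \<in> J'" if "h \<in> G" for h
    using insert.prems(2)[of h] that by (auto simp: J'_def intro: ideal.span_base)
  moreover have "ideal.span (insert g G \<union> J) \<subseteq> ideal.span (G \<union> J')"
    unfolding J'_def
    by (rule ideal.span_mono) (auto intro: ideal.span_base)
  then have "\<exists>u\<in>mpoly.span U. a - u \<in> ideal.span (G \<union> J')" for a
    using insert.prems(4)[of a] by blast
  ultimately obtain U1 where U1: "finite U1" "card U1 \<le> p ^ card G * card U"
      "\<And>a. \<exists>u\<in>mpoly.span U1. a - u \<in> J'"
    using insert.IH[of J'] insert.prems(3) by blast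
  have "ideal.span J = J" using insert.prems(1) by simp
  \<comment> \<open>Membership in \<open>J'\<close> means being a multiple of \<open>g\<close> up to
    \<open>J\<close>, which is the form that the removal of a single generator expects.\<close>
  then have "\<exists>h. a - g * h \<in> J" if "a \<in> J'" for a
  proof -
    from that obtain k where "a - k * g \<in> ideal.span J"
      unfolding J'_def ideal.span_breakdown_eq by blast
    then show ?thesis
      unfolding \<open>ideal.span J = J\<close> by (intro exI[of _ k]) (simp only: mult.commute)
  qed
  then have "\<exists>u\<in>mpoly.span U1. \<exists>h. a - u - g * h \<in> J" for a
    using U1(3)[of a] by blast
  then obtain U' where "finite U'" "card U' \<le> p * card U1" "\<forall>a. \<exists>u\<in>mpoly.span U'. a - u \<in> J"
    using spanning_mod_remove_generator[OF insert.prems(1) insert.prems(2)[OF insertI1] U1(1)] by blast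
  moreover have "p * card U1 \<le> p ^ card (insert g G) * card U"
    using U1(2) insert.hyps by (simp add: mult_le_mono2 mult.assoc)
  ultimately show ?case
    by (meson order.trans)
qed

section \<open>Local ideals and Nakayama's argument\<close>

text \<open>Models the maximal ideal of a local subring of the field.\<close>

locale local_ideal =
  fixes m :: "'a::field set"
  assumes zero_mem: "0 \<in> m" and one_notin: "1 \<notin> m"
    and uminus_mem: "a \<in> m \<Longrightarrow> - a \<in> m"
    and add_mem: "a \<in> m \<Longrightarrow> b \<in> m \<Longrightarrow> a + b \<in> m"
    and mult_mem: "a \<in> m \<Longrightarrow> b \<in> m \<Longrightarrow> a * b \<in> m"
    and div_mem: "a \<in> m \<Longrightarrow> b \<in> m \<Longrightarrow> a / (1 - b) \<in> m"
begin

lemma sum_mem: "(\<And>x. x \<in> A \<Longrightarrow> f x \<in> m) \<Longrightarrow> sum f A \<in> m"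
  by (induction A rule: infinite_finite_induct) (auto intro: zero_mem add_mem)

text \<open>This is Gaussian elimination: the relation for \<open>r\<close> is solved for
  \<open>x r\<close>, as \<open>1 - d r\<close> is nonzero, and substituted into the others. The
  closure properties of \<open>m\<close> keep all new coefficients in \<open>m\<close>.\<close>

lemma nakayama:
  assumes "finite T" "mpoly.subspace Y"
    and "\<And>t. t \<in> T \<Longrightarrow> \<exists>c. (\<forall>u\<in>T. c u \<in> m) \<and> x t - (\<Sum>u\<in>T. msmult (c u) (x u)) \<in> Y"
  shows "t \<in> T \<Longrightarrow> x t \<in> Y"
  using assms(1,3)
proof (induction T arbitrary: t rule: finite_induct)
  case (insert r T)
  note sub = mpoly.subspace_add[OF assms(2)] mpoly.subspace_scale[OF assms(2)]
  obtain d where d: "\<And>u. u \<in> insert r T \<Longrightarrow> d u \<in> m"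
      "x r - (\<Sum>u\<in>insert r T. msmult (d u) (x u)) \<in> Y"
    using insert.prems(2)[of r] by blast
  \<comment> \<open>Coefficients of the relation once it is solved for \<open>x r\<close>.\<close>
  define e where "e u = d u / (1 - d r)" for u
  have e: "e u \<in> m" if "u \<in> T" for u
    using that d(1) by (simp add: e_def div_mem)
  have ne: "1 - d r \<noteq> 0"
    using d(1)[of r] one_notin by auto
  have "msmult (1 / (1 - d r)) (x r - (\<Sum>u\<in>insert r T. msmult (d u) (x u))) =
      msmult (1 / (1 - d r)) (msmult (1 - d r) (x r)) - (\<Sum>u\<in>T. msmult (e u) (x u))"
    using insert.hyps
    by (simp add: mpoly.scale_right_diff_distrib mpoly.scale_left_diff_distrib
        mpoly.scale_right_distrib mpoly.scale_sum_right e_def)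
  also have "\<dots> = x r - (\<Sum>u\<in>T. msmult (e u) (x u))"
    using ne by simp
  finally have r: "x r - (\<Sum>u\<in>T. msmult (e u) (x u)) \<in> Y"
    using sub(2)[OF d(2), of "1 / (1 - d r)"] by simp
  have T: "x u \<in> Y" if "u \<in> T" for u
  proof (rule insert.IH[OF that])
    fix t assume "t \<in> T"
    then obtain c where c: "\<And>u. u \<in> insert r T \<Longrightarrow> c u \<in> m"
        "x t - (\<Sum>u\<in>insert r T. msmult (c u) (x u)) \<in> Y"
      using insert.prems(2)[of t] by blast
    have "x t - (\<Sum>u\<in>T. msmult (c u + c r * e u) (x u)) =
        (x t - (\<Sum>u\<in>insert r T. msmult (c u) (x u))) +
        msmult (c r) (x r - (\<Sum>u\<in>T. msmult (e u) (x u)))"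
      using insert.hyps
      by (simp add: mpoly.scale_right_diff_distrib mpoly.scale_left_distrib
          mpoly.scale_sum_right sum.distrib)
    also have "\<dots> \<in> Y"
      by (intro sub c(2) r)
    finally show "\<exists>c. (\<forall>u\<in>T. c u \<in> m) \<and> x t - (\<Sum>u\<in>T. msmult (c u) (x u)) \<in> Y"
      using c(1) e by (intro exI[of _ "\<lambda>u. c u + c r * e u"]) (auto intro!: add_mem mult_mem)
  qed
  have "(\<Sum>u\<in>T. msmult (e u) (x u)) \<in> Y"
    using T by (intro mpoly.subspace_sum[OF assms(2)] sub(2))
  then have "x r \<in> Y"
    using sub(1)[OF r, of "\<Sum>u\<in>T. msmult (e u) (x u)"] by simp
  with T insert.prems(1) show ?case by blast
qed simp

end

section \<open>Squarefree monomials\<close>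

definition sqfree :: "nat set \<Rightarrow> (nat \<Rightarrow>\<^sub>0 nat)" where
  "sqfree S = (\<Sum>v\<in>S. single v 1)"

lemma lookup_sqfree: "finite S \<Longrightarrow> lookup (sqfree S) v = (if v \<in> S then 1 else 0)"
  by (simp add: sqfree_def lookup_sum lookup_single when_def)

lemma keys_sqfree [simp]: "finite S \<Longrightarrow> keys (sqfree S) = S"
  by (auto simp: in_keys_iff lookup_sqfree split: if_splits)

lemma sqfree_eq_iff [simp]: "finite S \<Longrightarrow> finite T \<Longrightarrow> sqfree S = sqfree T \<longleftrightarrow> S = T"
  by (metis keys_sqfree)

lemma sqfree_Un: "finite S \<Longrightarrow> finite T \<Longrightarrow> S \<inter> T = {} \<Longrightarrow> sqfree (S \<union> T) = sqfree S + sqfree T"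
  by (simp add: sqfree_def sum.union_disjoint)

text \<open>The exponents of the two factors add up to at most 1 at each variable.\<close>

lemma sqfree_summand:
  assumes "finite S" "sqfree S = a + b"
  shows "b = sqfree (keys b)" "keys b \<subseteq> S"
proof -
  have ab: "lookup a v + lookup b v = (if v \<in> S then 1 else 0)" for v
    by (metis assms lookup_add lookup_sqfree)
  show "keys b \<subseteq> S"
  proof
    fix v assume "v \<in> keys b"
    then show "v \<in> S" using ab[of v] by (auto simp: in_keys_iff split: if_splits)
  qed
  show "b = sqfree (keys b)"
  proof (rule poly_mapping_eqI)
    fix v
    show "lookup b v = lookup (sqfree (keys b)) v"
      using ab[of v] by (auto simp: lookup_sqfree in_keys_iff split: if_splits)
  qed
qed

text \<open>All other monomials are left free, including those with a variable outside
  \<open>W\<close>. So the squarefree monomials in the variables of \<open>W\<close> represent a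
  basis of the quotient.\<close>

definition non_sqfree :: "nat set \<Rightarrow> 'a::comm_ring_1 mpoly set" where
  "non_sqfree W = {q. \<forall>S\<subseteq>W. lookup q (sqfree S) = 0}"

text \<open>A divisor of a squarefree monomial over \<open>W\<close> is again one, so a product can
  contain such a monomial only if the factor \<open>q\<close> does.\<close>

lemma subspace_non_sqfree:
  assumes "finite W"
  shows "ideal.subspace (non_sqfree W)"
proof (rule ideal.subspaceI)
  fix h q :: "'a mpoly"
  assume q: "q \<in> non_sqfree W"
  have "lookup (h * q) (sqfree S) = 0" if "S \<subseteq> W" for S
  proof (rule ccontr)
    assume "lookup (h * q) (sqfree S) \<noteq> 0"
    then have "sqfree S \<in> keys (h * q)" by (simp add: in_keys_iff)
    then obtain a b where ab: "sqfree S = a + b" "b \<in> keys q"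
      using keys_mult[of h q] by blast
    have "finite S" using that assms finite_subset by blast
    from sqfree_summand[OF this ab(1)] that q have "lookup q b = 0"
      unfolding non_sqfree_def by (metis (mono_tags, lifting) mem_Collect_eq order.trans)
    with ab(2) show False by (simp add: in_keys_iff)
  qed
  then show "h * q \<in> non_sqfree W" by (simp add: non_sqfree_def)
qed (simp_all add: non_sqfree_def lookup_add)

lemma CHAR_mpoly: "CHAR('a::comm_semiring_1 mpoly) = CHAR('a)"
proof (rule CHAR_eqI)
  have *: "of_nat n = (0 :: 'a mpoly) \<longleftrightarrow> of_nat n = (0 :: 'a)" for n
  proof
    show "of_nat n = (0 :: 'a)" if "of_nat n = (0 :: 'a mpoly)"
      using arg_cong[OF that, of "\<lambda>q. lookup q 0"] by (simp add: lookup_of_nat)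
    show "of_nat n = (0 :: 'a mpoly)" if "of_nat n = (0 :: 'a)"
      using that by (intro poly_mapping_eqI) (simp add: lookup_of_nat)
  qed
  show "of_nat CHAR('a) = (0 :: 'a mpoly)"
    by (simp add: *)
  show "CHAR('a) dvd n" if "of_nat n = (0 :: 'a mpoly)" for n
    using that by (simp add: * of_nat_eq_0_iff_char_dvd)
qed

lemma single_power:
  "\<exists>s. single t c ^ n = single s (c ^ n) \<and> (\<forall>v. lookup s v = n * lookup t v)"
  for t :: "nat \<Rightarrow>\<^sub>0 nat" and c :: "'a::comm_semiring_1"
proof (induction n)
  case (Suc n)
  then obtain s where "single t c ^ n = single s (c ^ n)" "\<forall>v. lookup s v = n * lookup t v"
    by blast
  then show ?case
    by (intro exI[of _ "t + s"]) (simp add: mult_single lookup_add)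
qed (auto intro: exI[of _ 0])

text \<open>Taking the power \<open>CHAR('a)\<close> is additive, so it suffices to treat
  nonconstant monomials; there some exponent becomes a positive multiple of the characteristic,
  hence at least 2.\<close>

lemma power_CHAR_mem_non_sqfree:
  fixes a :: "'a::comm_ring_1 mpoly"
  assumes "prime CHAR('a)" "lookup a 0 = 0" "finite W"
  shows "a ^ CHAR('a) \<in> non_sqfree W"
proof -
  let ?p = "CHAR('a)"
  have "(single t c) ^ ?p \<in> non_sqfree W" if "t \<noteq> 0" for t and c :: 'a
  proof -
    obtain s where s: "single t c ^ ?p = single s (c ^ ?p)" "\<And>v. lookup s v = ?p * lookup t v"
      using single_power by blast
    have "\<exists>v. lookup t v \<noteq> 0"
      using that by (auto simp: poly_mapping_eq_iff fun_eq_iff)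
    then obtain v where "lookup t v \<noteq> 0" ..
    then have "lookup s v \<ge> 2 * 1"
      using prime_ge_2_nat[OF assms(1)] unfolding s(2) by (intro mult_le_mono) auto
    then have "s \<noteq> sqfree S" if "S \<subseteq> W" for S
      using lookup_sqfree[OF finite_subset[OF that assms(3)], of v] by (auto split: if_splits)
    then show ?thesis
      by (auto simp: s non_sqfree_def lookup_single when_def)
  qed
  moreover have "a ^ ?p = (\<Sum>t\<in>keys a. single t (lookup a t) ^ ?p)"
  proof -
    have "(\<Sum>t\<in>keys a. single t (lookup a t)) ^ ?p = (\<Sum>t\<in>keys a. single t (lookup a t) ^ ?p)"
      using assms(1) by (intro freshmans_dream_sum) (simp_all add: CHAR_mpoly)
    then show ?thesis using poly_mapping_sum_monomials[of a] by metis
  qed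
  moreover have "t \<noteq> 0" if "t \<in> keys a" for t
    using that assms(2) by (auto simp: in_keys_iff)
  ultimately show ?thesis
    by (simp add: ideal.subspace_sum[OF subspace_non_sqfree[OF assms(3)]])
qed

text \<open>The projection \<rho> to the squarefree part over \<open>W\<close> vanishes on
  \<open>non_sqfree W\<close>, so the image of \<open>U\<close> spans all squarefree monomials over
  \<open>W\<close>. These are linearly independent.\<close>

lemma card_spanning_mod_non_sqfree:
  fixes U :: "'a::field mpoly set"
  assumes "finite W" "finite U" and gen: "\<And>a. \<exists>u\<in>mpoly.span U. a - u \<in> non_sqfree W"
  shows "2 ^ card W \<le> card U"
proof -
  define \<rho> :: "'a mpoly \<Rightarrow> 'a mpoly"
    where "\<rho> q = (\<Sum>S\<in>Pow W. single (sqfree S) (lookup q (sqfree S)))" for q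
  define X :: "'a mpoly set" where "X = (\<lambda>S. single (sqfree S) 1) ` Pow W"
  have fin: "finite S" if "S \<in> Pow W" for S
    using that assms(1) finite_subset by blast
  have rho_add: "\<rho> (a + b) = \<rho> a + \<rho> b" for a b
    by (simp add: \<rho>_def lookup_add single_add sum.distrib)
  have rho_scale: "\<rho> (msmult c a) = msmult c (\<rho> a)" for c a
    unfolding \<rho>_def mpoly.scale_sum_right
    by (intro sum.cong refl)
       (simp add: lookup_msmult, simp add: msmult_def mconst_def mult_single)
  have rho_span: "\<rho> u \<in> mpoly.span (\<rho> ` U)" if "u \<in> mpoly.span U" for u
    using that
  proof (induction rule: mpoly.span_induct_alt)
    case base
    have "\<rho> 0 = 0" by (simp add: \<rho>_def)
    then show ?case by (simp add: mpoly.span_zero)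
  next
    case (step c x y)
    then have "\<rho> x \<in> \<rho> ` U" by blast
    then show ?case
      using step by (simp only: rho_add rho_scale mpoly.span_add mpoly.span_scale mpoly.span_base)
  qed
  have rho_X: "\<rho> (single (sqfree S) 1) = single (sqfree S) 1" if "S \<in> Pow W" for S
  proof -
    have "\<rho> (single (sqfree S) 1) = (\<Sum>T\<in>Pow W. if T = S then single (sqfree S) 1 else 0)"
      unfolding \<rho>_def using fin that
      by (intro sum.cong refl) (auto simp: lookup_single when_def)
    then show ?thesis using that assms(1) by simp
  qed
  have "X \<subseteq> mpoly.span (\<rho> ` U)"
  proof
    fix x assume "x \<in> X"
    then obtain S where S: "S \<in> Pow W" "x = single (sqfree S) 1" by (auto simp: X_def)
    obtain u where u: "u \<in> mpoly.span U" "x - u \<in> non_sqfree W" using gen by blast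
    have "\<rho> (x - u) = 0" using u(2) by (simp add: \<rho>_def non_sqfree_def)
    then have "\<rho> x = \<rho> u" using rho_add[of "x - u" u] by simp
    then show "x \<in> mpoly.span (\<rho> ` U)" using rho_span[OF u(1)] rho_X S by simp
  qed
  have inj: "inj_on (\<lambda>S. single (sqfree S) (1::'a)) (Pow W)"
  proof (rule inj_onI)
    fix S T assume "S \<in> Pow W" "T \<in> Pow W" "single (sqfree S) (1::'a) = single (sqfree T) 1"
    then have "keys (single (sqfree S) (1::'a)) = keys (single (sqfree T) (1::'a))"
      by simp
    then show "S = T" using fin \<open>S \<in> Pow W\<close> \<open>T \<in> Pow W\<close> by simp
  qed
  have "mpoly.independent X"
  proof (rule mpoly.independent_if_scalars_zero)
    show "finite X" using assms(1) by (simp add: X_def)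
    fix f x assume sum0: "(\<Sum>x\<in>X. msmult (f x) x) = 0" and "x \<in> X"
    then obtain S where S: "S \<in> Pow W" "x = single (sqfree S) 1" by (auto simp: X_def)
    have "0 = lookup (\<Sum>x\<in>X. msmult (f x) x) (sqfree S)"
      by (simp add: sum0)
    also have "\<dots> = (\<Sum>T\<in>Pow W. if T = S then f x else 0)"
      unfolding X_def sum.reindex[OF inj] o_def lookup_sum lookup_msmult using fin S
      by (intro sum.cong refl) (auto simp: lookup_single when_def)
    finally show "f x = 0" using S assms(1) by simp
  qed
  then have "card X \<le> card (\<rho> ` U)"
    using mpoly.independent_span_bound[OF finite_imageI[OF assms(2)] _ \<open>X \<subseteq> mpoly.span (\<rho> ` U)\<close>]
    by blast
  also have "\<dots> \<le> card U" by (rule card_image_le[OF assms(2)])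
  finally show ?thesis
    using assms(1) by (simp add: X_def card_image[OF inj] card_Pow)
qed

lemma sqfree_part_diff_mem:
  assumes "finite W"
  shows "q - (\<Sum>S\<in>Pow W. single (sqfree S) (lookup q (sqfree S))) \<in> non_sqfree W"
  unfolding non_sqfree_def mem_Collect_eq
proof (intro allI impI)
  fix T assume "T \<subseteq> W"
  have fin: "finite S" if "S \<subseteq> W" for S
    using that assms finite_subset by blast
  have "lookup (\<Sum>S\<in>Pow W. single (sqfree S) (lookup q (sqfree S))) (sqfree T) =
      (\<Sum>S\<in>Pow W. if S = T then lookup q (sqfree T) else 0)"
    unfolding lookup_sum using fin \<open>T \<subseteq> W\<close>
    by (intro sum.cong refl) (auto simp: lookup_single when_def)
  also have "\<dots> = lookup q (sqfree T)"
    using assms \<open>T \<subseteq> W\<close> by simp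
  finally show "lookup (q - (\<Sum>S\<in>Pow W. single (sqfree S) (lookup q (sqfree S)))) (sqfree T) = 0"
    by (simp add: lookup_minus)
qed

text \<open>Such a set is determined by its intersections with the blocks, and each intersection is
  one of the \<open>2 ^ r - 1\<close> proper subsets of its block.\<close>

lemma card_subsets_containing_no_block:
  fixes B :: "nat \<Rightarrow> 'b set"
  assumes "\<And>b. b < s \<Longrightarrow> finite (B b)" "\<And>b. b < s \<Longrightarrow> card (B b) = r"
  shows "card {S. S \<subseteq> (\<Union>b<s. B b) \<and> (\<forall>b<s. \<not> B b \<subseteq> S)} \<le> (2 ^ r - 1) ^ s"
    (is "card ?M \<le> _")
proof -
  let ?P = "PiE {..<s} (\<lambda>b. Pow (B b) - {B b})"
  let ?f = "\<lambda>S. restrict (\<lambda>b. S \<inter> B b) {..<s}"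
  have "inj_on ?f ?M"
  proof (rule inj_onI)
    fix S T assume "S \<in> ?M" "T \<in> ?M" "?f S = ?f T"
    have "S \<inter> B b = T \<inter> B b" if "b < s" for b
      using that fun_cong[OF \<open>?f S = ?f T\<close>, of b] by simp
    then have "S \<inter> (\<Union>b<s. B b) = T \<inter> (\<Union>b<s. B b)" by blast
    with \<open>S \<in> ?M\<close> \<open>T \<in> ?M\<close> show "S = T" by blast
  qed
  moreover have "?f ` ?M \<subseteq> ?P"
  proof (rule image_subsetI, rule restrict_PiE_iff[THEN iffD2], rule ballI)
    fix S b assume "S \<in> ?M" "b \<in> {..<s}"
    then have "\<not> B b \<subseteq> S" by blast
    then show "S \<inter> B b \<in> Pow (B b) - {B b}" by blast
  qed
  moreover have "finite ?P"
    using assms by (intro finite_PiE) auto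
  ultimately have "card ?M \<le> card ?P"
    by (intro card_inj_on_le)
  also have "\<dots> = (\<Prod>b<s. card (Pow (B b) - {B b}))"
    by (simp add: card_PiE)
  also have "\<dots> = (\<Prod>b<s. 2 ^ r - 1)"
    using assms by (intro prod.cong refl) (simp add: card_Diff_singleton card_Pow)
  finally show ?thesis by simp
qed

section \<open>Lower bound for the number of generators\<close>

lemma (in local_ideal) lookup_monomial_mult_mem:
  assumes "\<And>t. lookup q t \<in> m"
  shows "lookup (single s 1 * q) t \<in> m"
proof -
  have "single s 1 * q = (\<Sum>u\<in>keys q. single (s + u) (lookup q u))"
    by (subst poly_mapping_sum_monomials[of q]) (simp add: sum_distrib_left mult_single)
  then have "lookup (single s 1 * q) t = (\<Sum>u\<in>keys q. lookup (single (s + u) (lookup q u)) t)"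
    by (simp add: lookup_sum)
  also have "\<dots> \<in> m"
    using assms zero_mem by (intro sum_mem) (auto simp: lookup_single when_def)
  finally show ?thesis .
qed

text \<open>Squarefree multiples of a block monomial are congruent to combinations of squarefree
  monomials with coefficients in \<open>m\<close>, so by \<open>nakayama\<close> the squarefree
  monomials containing no block span modulo \<open>Z\<close>. Removing the generators in
  \<open>G\<close> multiplies their number by at most \<open>CHAR('a) ^ card G\<close>, and modulo
  \<open>non_sqfree V\<close> at least \<open>2 ^ card V\<close> elements are needed.\<close>

lemma (in local_ideal) two_power_le_of_blocks_mem_ideal:
  fixes G :: "'a mpoly set" and B :: "nat \<Rightarrow> nat set"
  assumes prime: "prime CHAR('a)"
    and G: "finite G" "\<And>g. g \<in> G \<Longrightarrow> lookup g 0 = 0"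
    and B: "\<And>b. b < s \<Longrightarrow> finite (B b)" "\<And>b. b < s \<Longrightarrow> card (B b) = r"
    and disj: "\<And>b c. b < s \<Longrightarrow> c < s \<Longrightarrow> b \<noteq> c \<Longrightarrow> B b \<inter> B c = {}"
    and q: "\<And>b t. b < s \<Longrightarrow> lookup (q b) t \<in> m"
    and mem: "\<And>b. b < s \<Longrightarrow>
      single (sqfree (B b)) 1 + q b \<in> ideal.span (G \<union> non_sqfree (\<Union>b<s. B b))"
  shows "2 ^ (r * s) \<le> CHAR('a) ^ card G * (2 ^ r - 1) ^ s"
proof -
  define V where "V = (\<Union>b<s. B b)"
  define x where "x S = single (sqfree S) (1::'a)" for S
  define M where "M = {S. S \<subseteq> V \<and> (\<forall>b<s. \<not> B b \<subseteq> S)}"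
  define Z where "Z = ideal.span (G \<union> non_sqfree V)"
  define Y where "Y = {a. \<exists>u\<in>mpoly.span (x ` M). a - u \<in> Z}"
  have finV: "finite V"
    using B by (auto simp: V_def)
  have cardV: "card V = r * s"
    unfolding V_def using B disj by (subst card_UN_disjoint) auto
  have Z: "ideal.subspace Z" "non_sqfree V \<subseteq> Z"
    by (auto simp: Z_def intro: ideal.span_base)
  have Y: "mpoly.subspace Y"
  proof (rule mpoly.subspaceI)
    show "0 \<in> Y"
      using mpoly.span_zero ideal.subspace_0[OF Z(1)] by (force simp: Y_def)
    show "a + b \<in> Y" if "a \<in> Y" "b \<in> Y" for a b
    proof -
      obtain u w where "u \<in> mpoly.span (x ` M)" "a - u \<in> Z" "w \<in> mpoly.span (x ` M)" "b - w \<in> Z"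
        using \<open>a \<in> Y\<close> \<open>b \<in> Y\<close> unfolding Y_def by blast
      then have "u + w \<in> mpoly.span (x ` M)" "(a - u) + (b - w) \<in> Z"
        using ideal.subspace_add[OF Z(1)] mpoly.span_add by blast+
      then show ?thesis
        unfolding Y_def by (auto simp: algebra_simps intro!: bexI[of _ "u + w"])
    qed
    show "msmult c a \<in> Y" if "a \<in> Y" for c a
    proof -
      obtain u where "u \<in> mpoly.span (x ` M)" "a - u \<in> Z"
        using \<open>a \<in> Y\<close> unfolding Y_def by blast
      then have "msmult c u \<in> mpoly.span (x ` M)" "mconst c * (a - u) \<in> Z"
        using ideal.subspace_scale[OF Z(1)] mpoly.span_scale by blast+
      then show ?thesis
        unfolding Y_def by (auto simp: msmult_def algebra_simps intro!: bexI[of _ "mconst c * u"])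
    qed
  qed
  have ZY: "a \<in> Y" if "a \<in> Z" for a
    using that mpoly.span_zero by (force simp: Y_def)
  have xY: "x S \<in> Y" if "S \<in> Pow V" for S
  proof (rule nakayama[of "Pow V" Y x, OF _ Y _ that])
    show "finite (Pow V)" using finV by simp
    fix S assume S: "S \<in> Pow V"
    show "\<exists>c. (\<forall>u\<in>Pow V. c u \<in> m) \<and> x S - (\<Sum>u\<in>Pow V. msmult (c u) (x u)) \<in> Y"
    proof (cases "S \<in> M")
      case True
      then have "x S \<in> mpoly.span (x ` M)" by (auto intro: mpoly.span_base)
      then have "x S \<in> Y"
        using ideal.subspace_0[OF Z(1)] by (force simp: Y_def)
      \<comment> \<open>As \<open>x S\<close> is already in \<open>Y\<close>, the relation with all
        coefficients zero suffices.\<close>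
      then show ?thesis
        by (intro exI[of _ "\<lambda>_. 0"]) (simp add: zero_mem)
    next
      case False
      then obtain b where b: "b < s" "B b \<subseteq> S" using S by (auto simp: M_def)
      \<comment> \<open>The cofactor of the block in \<open>x S\<close>: multiplying the relation
        for the block by it expresses \<open>x S\<close> through \<open>h * q b\<close>.\<close>
      define h where "h = single (sqfree (S - B b)) (1::'a)"
      have "finite S" using S finV finite_subset by blast
      then have "sqfree (S - B b \<union> B b) = sqfree (S - B b) + sqfree (B b)"
        using b B(1)[of b] by (intro sqfree_Un) auto
      moreover have "S - B b \<union> B b = S" using b(2) by blast
      ultimately have "sqfree S = sqfree (S - B b) + sqfree (B b)" by (simp only:)
      then have "h * (single (sqfree (B b)) 1 + q b) = x S + h * q b"
        by (simp add: h_def x_def algebra_simps mult_single)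
      then have "x S + h * q b \<in> Z"
        using ideal.subspace_scale[OF Z(1), of "single (sqfree (B b)) 1 + q b" h] mem[OF b(1)]
        by (simp add: Z_def V_def)
      \<comment> \<open>Modulo \<open>non_sqfree V\<close> the product \<open>h * q b\<close> equals
        its squarefree part, and the negated coefficients of that part are the ones
        required.\<close>
      define c where "c T = - lookup (h * q b) (sqfree T)" for T
      have "msmult (c T) (x T) = - single (sqfree T) (lookup (h * q b) (sqfree T))" for T
        by (simp add: msmult_def mconst_def x_def c_def mult_single single_uminus)
      then have "x S - (\<Sum>T\<in>Pow V. msmult (c T) (x T)) = (x S + h * q b) -
          (h * q b - (\<Sum>T\<in>Pow V. single (sqfree T) (lookup (h * q b) (sqfree T))))"
        by (simp add: sum_negf)
      also have "\<dots> \<in> Z"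
        using \<open>x S + h * q b \<in> Z\<close> subsetD[OF Z(2) sqfree_part_diff_mem[OF finV]]
        by (rule ideal.subspace_diff[OF Z(1)])
      finally have "x S - (\<Sum>T\<in>Pow V. msmult (c T) (x T)) \<in> Y"
        by (rule ZY)
      moreover have "c T \<in> m" for T
        unfolding c_def h_def
        by (intro uminus_mem lookup_monomial_mult_mem q[OF b(1)])
      ultimately show ?thesis by blast
    qed
  qed
  have gen: "\<exists>u\<in>mpoly.span (x ` M). a - u \<in> ideal.span (G \<union> non_sqfree V)" for a
  proof -
    have "(\<Sum>S\<in>Pow V. msmult (lookup a (sqfree S)) (x S)) \<in> Y"
      by (intro mpoly.subspace_sum[OF Y] mpoly.subspace_scale[OF Y] xY)
    moreover have "a - (\<Sum>S\<in>Pow V. msmult (lookup a (sqfree S)) (x S)) \<in> Y"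
      using ZY[OF subsetD[OF Z(2) sqfree_part_diff_mem[OF finV, of a]]]
      by (simp add: msmult_def mconst_def x_def mult_single)
    ultimately have "a \<in> Y"
      using mpoly.subspace_add[OF Y] by fastforce
    then show ?thesis by (simp add: Y_def Z_def)
  qed
  have fin: "finite (x ` M)"
    using finV by (simp add: M_def)
  have pow: "g ^ CHAR('a) \<in> non_sqfree V" if "g \<in> G" for g
    using power_CHAR_mem_non_sqfree[OF prime G(2)[OF that] finV] .
  have "\<exists>U :: 'a mpoly set. finite U \<and> card U \<le> CHAR('a) ^ card G * card (x ` M) \<and>
      (\<forall>a. \<exists>u\<in>mpoly.span U. a - u \<in> non_sqfree V)"
    by (rule spanning_mod_remove_generators[OF G(1) subspace_non_sqfree[OF finV] pow fin gen])
  then obtain U :: "'a mpoly set" where U: "finite U" "card U \<le> CHAR('a) ^ card G * card (x ` M)"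
      "\<And>a. \<exists>u\<in>mpoly.span U. a - u \<in> non_sqfree V"
    by blast
  have "card (x ` M) \<le> card M"
    using finV by (intro card_image_le) (simp add: M_def)
  also have "\<dots> \<le> (2 ^ r - 1) ^ s"
    unfolding M_def V_def by (rule card_subsets_containing_no_block[OF B])
  finally have "card U \<le> CHAR('a) ^ card G * (2 ^ r - 1) ^ s"
    using U(2) by (meson mult_le_mono2 order.trans)
  then show ?thesis
    using card_spanning_mod_non_sqfree[OF finV U(1,3)] unfolding cardV by (rule order.trans[rotated])
qed

section \<open>The block polynomial\<close>

text \<open>Numbering starts at 1 to match \<open>mpolys\<close>. The first variable of each block
  is reserved for differentiation, which leaves \<open>p\<close> others.\<close>

definition block_poly :: "nat \<Rightarrow> nat \<Rightarrow> 'a::comm_ring_1 mpoly" where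
  "block_poly p s = (\<Sum>b<s. single (sqfree {b * Suc p + 1..Suc b * Suc p}) 1)"

lemma block_le:
  assumes "b < (c::nat)"
  shows "Suc b * Suc p \<le> c * Suc p"
  using assms by (intro mult_le_mono1) simp

text \<open>The first variable of block \<open>b\<close> occurs in no other block, so this
  derivative isolates a single block.\<close>

lemma pdiff_block_poly:
  assumes "b < s"
  shows "pdiff (b * Suc p + 1) (block_poly p s) = single (sqfree {b * Suc p + 2..Suc b * Suc p}) 1"
proof -
  let ?v = "b * Suc p + 1"
  have "pdiff ?v (single (sqfree {c * Suc p + 1..Suc c * Suc p}) 1) =
      (if c = b then single (sqfree {b * Suc p + 2..Suc b * Suc p}) (1::'a) else 0)" for c
  proof (cases "c = b")
    case True
    have "{b * Suc p + 1..Suc b * Suc p} = {?v} \<union> {b * Suc p + 2..Suc b * Suc p}"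
      by auto
    then have "sqfree {b * Suc p + 1..Suc b * Suc p} =
        single ?v 1 + sqfree {b * Suc p + 2..Suc b * Suc p}"
      using sqfree_Un[of "{?v}" "{b * Suc p + 2..Suc b * Suc p}"] by (simp add: sqfree_def)
    then have "sqfree {b * Suc p + 1..Suc b * Suc p} - single ?v 1 =
        sqfree {b * Suc p + 2..Suc b * Suc p}"
      by simp
    with True show ?thesis
      unfolding pdiff_single by (simp add: lookup_sqfree)
  next
    case False
    then have "?v \<notin> {c * Suc p + 1..Suc c * Suc p}"
      using block_le[of b c p] block_le[of c b p] by (cases "b < c") auto
    then have "lookup (sqfree {c * Suc p + 1..Suc c * Suc p}) ?v = 0"
      by (simp only: lookup_sqfree[OF finite_atLeastAtMost] if_False)
    with False show ?thesis
      by (simp only: pdiff_single) simp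
  qed
  then show ?thesis
    using assms by (simp add: block_poly_def pdiff_sum)
qed

lemma lookup_mult_0:
  fixes a b :: "'a::comm_semiring_1 mpoly"
  assumes "lookup a 0 = 0"
  shows "lookup (a * b) 0 = 0"
proof (rule ccontr)
  assume "lookup (a * b) 0 \<noteq> 0"
  then obtain s t where st: "0 = s + t" "s \<in> keys a"
    using keys_mult[of a b] by (auto simp: in_keys_iff)
  have "lookup s v = 0" for v
    using arg_cong[OF st(1), of "\<lambda>u. lookup u v"] by (simp add: lookup_add)
  then have "s = 0" by (intro poly_mapping_eqI) simp
  with st(2) assms show False by (simp add: in_keys_iff)
qed

text \<open>Makes the ideal generators nilpotent modulo \<open>non_sqfree\<close>: every product in
  the sum has at least one factor, and that factor has no constant term.\<close>

lemma lookup_esym_0: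
  fixes y :: "nat \<Rightarrow> 'a::comm_semiring_1 mpoly"
  assumes "\<And>j. j \<in> {1..m} \<Longrightarrow> lookup (y j) 0 = 0" "q \<ge> 1"
  shows "lookup (esym q m y) 0 = 0"
  unfolding esym_def lookup_sum
proof (rule sum.neutral, clarify)
  fix S assume S: "S \<subseteq> {1..m}" "q = card S"
  then obtain j where "j \<in> S" using assms(2) by fastforce
  moreover have "finite S" using S finite_subset by blast
  ultimately have "prod y S = y j * prod y (S - {j})" by (simp add: prod.remove)
  then show "lookup (prod y S) 0 = 0"
    using lookup_mult_0 assms(1) S \<open>j \<in> S\<close> by (metis subsetD)
qed

text \<open>Covers both settings: \<open>e\<close> and \<open>q\<close> are 1 and 0 in the exact
  case, a power of \<open>eps\<close> and a multiple of \<open>eps\<close> in the border case.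
  Differentiating \<open>eq\<close> by the first variable of each block puts the perturbed product
  of the other \<open>p\<close> variables into \<open>Z\<close>.\<close>

lemma (in local_ideal) two_power_le_of_esym_sum:
  fixes L :: "nat \<Rightarrow> nat \<Rightarrow> 'a mpoly"
  defines "p \<equiv> CHAR('a)"
  assumes prime: "prime p"
    and L: "\<And>i j. i \<in> {1..k} \<Longrightarrow> j \<in> {1..n i} \<Longrightarrow> lookup (L i j) 0 = 0"
    and eq: "(\<Sum>i=1..k. mconst (c i) * esym (Suc p) (n i) (L i)) = mconst e * (block_poly p s + q)"
    and e: "e \<noteq> 0" and q: "\<And>t. lookup q t \<in> m"
  shows "2 ^ (p * s) \<le> p ^ (k * p) * (2 ^ p - 1) ^ s"
proof -
  \<comment> \<open>Degrees 1 to \<open>p\<close> for each of the \<open>k\<close> families of forms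
    give at most \<open>k * p\<close> generators.\<close>
  define G where "G = (\<lambda>(i, d). esym d (n i) (L i)) ` ({1..k} \<times> {1..p})"
  define B where "B b = {b * Suc p + 2..Suc b * Suc p}" for b
  define W where "W = (\<Union>b<s. B b)"
  define Z where "Z = ideal.span (G \<union> non_sqfree W)"
  have finW: "finite W" by (simp add: W_def B_def)
  have Z: "ideal.subspace Z" "G \<subseteq> Z" "non_sqfree W \<subseteq> Z"
    by (auto simp: Z_def intro: ideal.span_base)
  have G0: "lookup g 0 = 0" if "g \<in> G" for g
    using that by (auto simp: G_def intro!: lookup_esym_0 L)
  have "pdiff v (esym (Suc p) (n i) (L i)) \<in> Z" if "i \<in> {1..k}" for i v
    unfolding esym_conv_esym_on
  proof (rule pdiff_esym_on_mem_ideal[OF _ Z(1)])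
    show "esym_on d {1..n i} (L i) \<in> Z" if "1 \<le> d" "d \<le> p" for d
    proof (rule subsetD[OF Z(2)])
      show "esym_on d {1..n i} (L i) \<in> G"
        using that \<open>i \<in> {1..k}\<close> unfolding G_def esym_conv_esym_on
        by (intro image_eqI[of _ _ "(i, d)"]) auto
    qed
    show "L i j ^ p \<in> Z" if "j \<in> {1..n i}" for j
      using power_CHAR_mem_non_sqfree[OF prime[unfolded p_def] L[OF \<open>i \<in> {1..k}\<close> that] finW] Z(3)
      unfolding p_def by blast
  qed simp
  then have lhs: "pdiff v (\<Sum>i=1..k. mconst (c i) * esym (Suc p) (n i) (L i)) \<in> Z" for v
    unfolding pdiff_sum pdiff_mconst_mult
    by (intro ideal.subspace_sum[OF Z(1)] ideal.subspace_scale[OF Z(1)])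
  have "single (sqfree (B b)) 1 + pdiff (b * Suc p + 1) q \<in> Z" if "b < s" for b
  proof -
    have "mconst e * (single (sqfree (B b)) 1 + pdiff (b * Suc p + 1) q) \<in> Z"
      using lhs[of "b * Suc p + 1"] unfolding eq pdiff_mconst_mult pdiff_add pdiff_block_poly[OF that] B_def .
    then have "mconst (1 / e) * (mconst e * (single (sqfree (B b)) 1 + pdiff (b * Suc p + 1) q)) \<in> Z"
      by (rule ideal.subspace_scale[OF Z(1)])
    moreover have "mconst (1 / e) * mconst e = 1"
      using e by (simp add: mconst_def mult_single)
    ultimately show ?thesis
      by (simp only: mult.assoc[symmetric] mult_1_left)
  qed
  moreover have "lookup (pdiff v q) t \<in> m" for v t
  proof -
    \<comment> \<open>The derivative multiplies coefficients by natural numbers, and closure of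
      \<open>m\<close> under addition permits this.\<close>
    have "of_nat j * a \<in> m" if "a \<in> m" for j a
      using that by (induction j) (auto simp: algebra_simps intro: zero_mem add_mem)
    then show ?thesis unfolding lookup_pdiff using q by blast
  qed
  moreover have "finite (B b)" "card (B b) = p" for b
    by (simp_all add: B_def)
  moreover have "B b \<inter> B c = {}" if "b \<noteq> c" for b c
    using block_le[of b c p] block_le[of c b p] that by (cases "b < c") (auto simp: B_def)
  moreover have "finite G" by (simp add: G_def)
  ultimately have "2 ^ (p * s) \<le> p ^ card G * (2 ^ p - 1) ^ s"
    using two_power_le_of_blocks_mem_ideal[of G s B p "\<lambda>b. pdiff (b * Suc p + 1) q"] prime G0
    unfolding Z_def W_def p_def by blast
  moreover have "card G \<le> k * p"
    using card_image_le[of "{1..k} \<times> {1..p}" "\<lambda>(i, d). esym d (n i) (L i)"] by (simp add: G_def)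
  then have "p ^ card G \<le> p ^ (k * p)"
    using prime_gt_0_nat[OF prime] by (intro power_increasing) auto
  ultimately show ?thesis
    by (meson mult_le_mono1 order.trans)
qed

lemma block_poly_mem_mpolys: "block_poly p (n div Suc p) \<in> mpolys n"
  and homogeneous_block_poly: "homogeneous (Suc p) (block_poly p s)"
proof -
  have keys: "keys (block_poly p s) \<subseteq> (\<lambda>b. sqfree {b * Suc p + 1..Suc b * Suc p}) ` {..<s}" for s
    using keys_sum[of "\<lambda>b. single (sqfree {b * Suc p + 1..Suc b * Suc p}) 1" "{..<s}"]
    unfolding block_poly_def by (fastforce split: if_splits)
  have "Suc b * Suc p \<le> n" if "b < n div Suc p" for b
    using block_le[OF that, of p] div_times_less_eq_dividend[of n "Suc p"] by linarith
  then have "{b * Suc p + 1..Suc b * Suc p} \<subseteq> {1..n}" if "b < n div Suc p" for b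
    using that by (meson atLeastatMost_subset_iff le_add2)
  then show "block_poly p (n div Suc p) \<in> mpolys n"
    using keys[of "n div Suc p"] unfolding mpolys_def
    by (fastforce simp del: mult_Suc mult_Suc_right)
  show "homogeneous (Suc p) (block_poly p s)"
    unfolding homogeneous_def
  proof
    fix t assume "t \<in> keys (block_poly p s)"
    then obtain b where t: "t = sqfree {b * Suc p + 1..Suc b * Suc p}"
      using keys by blast
    have "monom_degree t = (\<Sum>v\<in>{b * Suc p + 1..Suc b * Suc p}. 1)"
      unfolding monom_degree_def t keys_sqfree[OF finite_atLeastAtMost]
      by (intro sum.cong refl) (simp only: lookup_sqfree[OF finite_atLeastAtMost] if_True)
    then show "monom_degree t = Suc p" by simp
  qed
qed

lemma lookup_0_linear_form:
  assumes "q \<in> linear_forms n"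
  shows "lookup q 0 = 0"
proof (rule ccontr)
  assume "lookup q 0 \<noteq> 0"
  then have "monom_degree 0 = 1"
    using assms by (auto simp: linear_forms_def homogeneous_def in_keys_iff)
  then show False by (simp add: monom_degree_def)
qed

section \<open>Local ideals for the exact and the border setting\<close>

lemma local_ideal_zero: "local_ideal {0 :: 'a::field}"
  by unfold_locales auto

text \<open>These are the rational functions vanishing at \<epsilon> = 0, the maximal ideal of the
  local ring of rational functions defined there.\<close>

lemma local_ideal_eps:
  "local_ideal {to_fract a / to_fract b | a b :: 'a::field poly. poly a 0 = 0 \<and> poly b 0 \<noteq> 0}"
    (is "local_ideal ?m")
proof
  have memI: "x \<in> ?m" if "x = to_fract a / to_fract b" "poly a 0 = 0" "poly b 0 \<noteq> 0" for x a b
    using that by blast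
  show "0 \<in> ?m" by (rule memI[of _ 0 1]) simp_all
  show "1 \<notin> ?m"
  proof
    assume "1 \<in> ?m"
    then obtain a b :: "'a poly" where "1 = to_fract a / to_fract b" "poly a 0 = 0" "poly b 0 \<noteq> 0"
      by blast
    then show False by (cases "b = 0") (auto simp: field_simps)
  qed
  fix x assume "x \<in> ?m"
  then obtain a b :: "'a poly" where ab: "x = to_fract a / to_fract b" "poly a 0 = 0" "poly b 0 \<noteq> 0"
    by blast
  have b: "b \<noteq> 0" using ab by auto
  show "- x \<in> ?m" by (rule memI[of _ "- a" b]) (use ab in simp_all)
  fix y assume "y \<in> ?m"
  then obtain c d :: "'a poly" where cd: "y = to_fract c / to_fract d" "poly c 0 = 0" "poly d 0 \<noteq> 0"
    by blast
  have d: "d \<noteq> 0" using cd by auto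
  have dc: "d - c \<noteq> 0" using cd by auto
  show "x + y \<in> ?m"
    by (rule memI[of _ "a * d + c * b" "b * d"]) (use ab cd b d in \<open>simp_all add: field_simps\<close>)
  show "x * y \<in> ?m"
    by (rule memI[of _ "a * c" "b * d"]) (use ab cd in simp_all)
  \<comment> \<open>At 0 the numerator \<open>d - c\<close> has the same nonzero value as
    \<open>d\<close>, so it may serve in a denominator.\<close>
  have "1 - y = to_fract (d - c) / to_fract d"
    using cd d by (simp add: field_simps)
  then show "x / (1 - y) \<in> ?m"
    by (intro memI[of _ "a * d" "b * (d - c)"]) (use ab cd in simp_all)
qed

text \<open>The block size comes from the characteristic of \<open>'a\<close>, but the power map is
  applied over the extension field.\<close>

lemma CHAR_poly_fract: "CHAR('a::field poly fract) = CHAR('a)"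
proof (rule CHAR_eqI)
  have *: "of_nat n = (0 :: 'a poly fract) \<longleftrightarrow> of_nat n = (0 :: 'a)" for n
    unfolding of_nat_fract of_nat_poly to_fract_def[symmetric] by simp
  show "of_nat CHAR('a) = (0 :: 'a poly fract)" by (simp only: * of_nat_CHAR)
  show "CHAR('a) dvd n" if "of_nat n = (0 :: 'a poly fract)" for n
    using that by (simp only: * of_nat_eq_0_iff_char_dvd)
qed

lemma lookup_map: "f 0 = 0 \<Longrightarrow> lookup (Poly_Mapping.map f q) t = f (lookup q t)"
  by (simp add: Poly_Mapping.map.rep_eq when_def)

text \<open>The embedding of coefficients is additive and maps 1 to 1, and \<open>block_poly\<close>
  is a sum of monomials with coefficient 1.\<close>

lemma lift_const_block_poly: "lift_const (block_poly p s) = block_poly p s"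
proof (rule poly_mapping_eqI)
  fix t
  define g :: "'a \<Rightarrow> 'a poly fract" where "g = (\<lambda>a. to_fract [:a:])"
  have g: "g 0 = 0" "g 1 = 1" "g (a + b) = g a + g b" for a b
    by (simp_all add: g_def flip: one_pCons to_fract_add)
  have "g (lookup (block_poly p s) t) = (\<Sum>b<s. g (lookup (single (sqfree {b * Suc p + 1..Suc b * Suc p}) 1) t))"
    unfolding block_poly_def lookup_sum by (induction s) (simp_all only: g lessThan_0 lessThan_Suc sum.empty
        sum.insert finite_lessThan lessThan_iff less_irrefl not_False_eq_True)
  also have "\<dots> = lookup (block_poly p s) t"
    unfolding block_poly_def lookup_sum by (intro sum.cong refl) (simp add: lookup_single when_def g)
  finally show "lookup (lift_const (block_poly p s)) t = lookup (block_poly p s :: 'a poly fract mpoly) t"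
    unfolding lift_const_def using g by (simp add: lookup_map flip: g_def)
qed

lemma eventually_two_power_gt:
  fixes p :: nat and k :: "nat \<Rightarrow> nat"
  assumes "p \<ge> 2" and k: "(\<lambda>n. real (k n)) \<in> o(\<lambda>n. real n)"
  shows "\<forall>\<^sub>F n in sequentially.
    p ^ (k n * p) * (2 ^ p - 1) ^ (n div Suc p) < 2 ^ (p * (n div Suc p))"
proof -
  \<comment> \<open>After taking logarithms the claim reads \<open>D * k n < c * s\<close> with
    \<open>s = n div Suc p\<close>.\<close>
  define c where "c = ln (2 ^ p :: real) - ln (2 ^ p - 1)"
  define D where "D = real p * ln (real p)"
  have p2: "(2::real) ^ p > 1" using assms by simp
  have c: "c > 0" unfolding c_def using p2 by simp
  have D: "D > 0" using assms by (simp add: D_def)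
  \<comment> \<open>Since \<open>s\<close> is roughly \<open>n / Suc p\<close>, the quantity
    \<open>k n\<close> has to stay below about \<open>c / (D * Suc p) * n\<close>; the factor 4
    absorbs the rounding.\<close>
  have "c / (4 * D * Suc p) > 0" using c D by (intro divide_pos_pos mult_pos_pos) auto
  from landau_o.smallD[OF k this]
  have ev: "\<forall>\<^sub>F n in sequentially. real (k n) \<le> c / (4 * D * Suc p) * real n" by simp
  show ?thesis
    using ev eventually_gt_at_top[of "2 * Suc p"]
  proof eventually_elim
    case (elim n)
    define s where "s = n div Suc p"
    have "real n = real (Suc p) * real s + real (n mod Suc p)"
      unfolding s_def by (metis mult_div_mod_eq of_nat_add of_nat_mult)
    moreover have "real (n mod Suc p) < real (Suc p)"
      unfolding of_nat_less_iff by (rule mod_less_divisor) simp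
    ultimately have "real n / Suc p < real s + 1" by (simp add: field_simps)
    then have s: "real s > real n / Suc p - 1" by simp
    have "D * real (k n) \<le> D * (c / (4 * D * Suc p) * real n)"
      using elim(1) D by (intro mult_left_mono) auto
    also have "\<dots> = c * ((real n / Suc p) / 4)"
    proof -
      have "D * (c / (4 * D * P) * N) = c * ((N / P) / 4)" if "P > 0" for P N :: real
        using D that by (simp add: field_simps)
      then show ?thesis by simp
    qed
    also have "\<dots> < c * real s"
    proof (rule mult_strict_left_mono[OF _ c])
      \<comment> \<open>For a quotient above 2, even a loss of 1 by rounding leaves more than a
        quarter of it.\<close>
      have "real n / Suc p > 2" using elim(2) by (simp add: field_simps)
      moreover have "x / 4 < y" if "2 < x" "x - 1 < y" for x y :: real
        using that by linarith
      ultimately show "real n / Suc p / 4 < real s" using s by blast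
    qed
    finally have "D * real (k n) < c * real s" .
    then have "real (k n * p) * ln (real p) + real s * ln (2 ^ p - 1) < real s * ln (2 ^ p)"
      by (simp add: c_def D_def algebra_simps)
    then have "ln (real p ^ (k n * p) * (2 ^ p - 1) ^ s) < ln ((2 ^ p) ^ s)"
      using p2 assms by (simp add: ln_mult ln_realpow)
    then have "real p ^ (k n * p) * (2 ^ p - 1) ^ s < (2 ^ p) ^ s"
      using p2 assms by (subst (asm) ln_less_cancel_iff) auto
    then have "real (p ^ (k n * p) * (2 ^ p - 1) ^ s) < real (2 ^ (p * s))"
      by (simp add: power_mult of_nat_diff)
    then show ?case
      unfolding s_def of_nat_less_iff .
  qed
qed

theorem theorem1p2:
  assumes "CHAR('a::field) \<noteq> 0"
  shows "\<exists>(f :: nat \<Rightarrow> 'a mpoly) (d :: nat \<Rightarrow> nat).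
    (\<forall>n. f n \<in> mpolys n \<and> homogeneous (d n) (f n)) \<and>
    (\<forall>k :: nat \<Rightarrow> nat. (\<lambda>n. real (k n)) \<in> o(\<lambda>n. real n) \<longrightarrow>
      (\<forall>\<^sub>F n in sequentially.
        (\<forall>(m :: nat \<Rightarrow> nat) (L :: nat \<Rightarrow> nat \<Rightarrow> 'a mpoly) (c :: nat \<Rightarrow> 'a).
          (\<forall>i\<in>{1..k n}. \<forall>j\<in>{1..m i}. L i j \<in> linear_forms n) \<longrightarrow>
          f n \<noteq> (\<Sum>i=1..k n. mconst (c i) * esym (d n) (m i) (L i))) \<and>
        (\<forall>(m :: nat \<Rightarrow> nat) (L :: nat \<Rightarrow> nat \<Rightarrow> 'a poly fract mpoly) (c :: nat \<Rightarrow> 'a poly fract).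
          (\<forall>i\<in>{1..k n}. \<forall>j\<in>{1..m i}. L i j \<in> linear_forms n) \<longrightarrow>
          \<not> (\<exists>(N :: nat) (Q :: 'a poly mpoly). Q \<in> mpolys n \<and>
                (\<Sum>i=1..k n. mconst (c i) * esym (d n) (m i) (L i)) =
                  mconst (eps ^ N) * lift_const (f n) + mconst (eps ^ (N + 1)) * lift_poly Q))))"
proof -
  define p where "p = CHAR('a)"
  have prime: "prime p"
    using assms by (simp add: p_def prime_CHAR_semidom)
  define m\<^sub>\<epsilon> where
    "m\<^sub>\<epsilon> = {to_fract a / to_fract b | a b :: 'a poly. poly a 0 = 0 \<and> poly b 0 \<noteq> 0}"
  \<comment> \<open>The exact setting has no perturbation, so the zero ideal serves there.\<close>
  interpret F: local_ideal "{0 :: 'a}" by (rule local_ideal_zero)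
  interpret E: local_ideal m\<^sub>\<epsilon> unfolding m\<^sub>\<epsilon>_def by (rule local_ideal_eps)
  \<comment> \<open>For \<open>n < Suc p\<close> there is no block and the polynomial is zero, which
    counts as homogeneous of degree \<open>Suc p\<close>.\<close>
  define s where "s n = n div Suc p" for n
  show ?thesis
  proof (intro exI[of _ "\<lambda>n. block_poly p (s n)"] exI[of _ "\<lambda>_. Suc p"] conjI allI impI)
    show "block_poly p (s n) \<in> mpolys n" "homogeneous (Suc p) (block_poly p (s n))" for n
      unfolding s_def by (rule block_poly_mem_mpolys homogeneous_block_poly)+
    fix k :: "nat \<Rightarrow> nat" assume "(\<lambda>n. real (k n)) \<in> o(\<lambda>n. real n)"
    from eventually_two_power_gt[OF prime_ge_2_nat[OF prime] this]
    show "\<forall>\<^sub>F n in sequentially.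
        (\<forall>(m :: nat \<Rightarrow> nat) (L :: nat \<Rightarrow> nat \<Rightarrow> 'a mpoly) (c :: nat \<Rightarrow> 'a).
          (\<forall>i\<in>{1..k n}. \<forall>j\<in>{1..m i}. L i j \<in> linear_forms n) \<longrightarrow>
          block_poly p (s n) \<noteq> (\<Sum>i=1..k n. mconst (c i) * esym (Suc p) (m i) (L i))) \<and>
        (\<forall>(m :: nat \<Rightarrow> nat) (L :: nat \<Rightarrow> nat \<Rightarrow> 'a poly fract mpoly) (c :: nat \<Rightarrow> 'a poly fract).
          (\<forall>i\<in>{1..k n}. \<forall>j\<in>{1..m i}. L i j \<in> linear_forms n) \<longrightarrow>
          \<not> (\<exists>(N :: nat) (Q :: 'a poly mpoly). Q \<in> mpolys n \<and>
                (\<Sum>i=1..k n. mconst (c i) * esym (Suc p) (m i) (L i)) =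
                  mconst (eps ^ N) * lift_const (block_poly p (s n)) +
                  mconst (eps ^ (N + 1)) * lift_poly Q))"
    proof eventually_elim
      case (elim n)
      note gt = elim[folded s_def]
      show ?case
      proof (intro conjI allI impI notI)
        fix m :: "nat \<Rightarrow> nat" and L :: "nat \<Rightarrow> nat \<Rightarrow> 'a mpoly" and c
        assume L: "\<forall>i\<in>{1..k n}. \<forall>j\<in>{1..m i}. L i j \<in> linear_forms n"
          and eq: "block_poly p (s n) = (\<Sum>i=1..k n. mconst (c i) * esym (Suc p) (m i) (L i))"
        have "(\<Sum>i=1..k n. mconst (c i) * esym (Suc CHAR('a)) (m i) (L i)) =
            mconst 1 * (block_poly CHAR('a) (s n) + 0)"
          using eq by (simp add: mconst_def p_def)
        moreover have "lookup (L i j) 0 = 0" if "i \<in> {1..k n}" "j \<in> {1..m i}" for i j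
          using L that lookup_0_linear_form by blast
        ultimately have "2 ^ (p * s n) \<le> p ^ (k n * p) * (2 ^ p - 1) ^ s n"
          using F.two_power_le_of_esym_sum[of "k n" m L c 1 "s n" 0] prime by (simp add: p_def)
        with gt show False by linarith
      next
        fix m :: "nat \<Rightarrow> nat" and L :: "nat \<Rightarrow> nat \<Rightarrow> 'a poly fract mpoly" and c
        assume L: "\<forall>i\<in>{1..k n}. \<forall>j\<in>{1..m i}. L i j \<in> linear_forms n"
          and "\<exists>(N :: nat) (Q :: 'a poly mpoly). Q \<in> mpolys n \<and>
            (\<Sum>i=1..k n. mconst (c i) * esym (Suc p) (m i) (L i)) =
              mconst (eps ^ N) * lift_const (block_poly p (s n)) +
              mconst (eps ^ (N + 1)) * lift_poly Q"
        then obtain N and Q :: "'a poly mpoly" where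
          eq: "(\<Sum>i=1..k n. mconst (c i) * esym (Suc p) (m i) (L i)) =
              mconst (eps ^ N) * lift_const (block_poly p (s n)) +
              mconst (eps ^ (N + 1)) * lift_poly Q" by blast
        let ?p = "CHAR('a poly fract)"
        have p: "?p = p" by (simp add: p_def CHAR_poly_fract)
        \<comment> \<open>Splitting off one factor \<open>eps\<close> leaves the common factor
          \<open>eps ^ N\<close> and makes \<open>eps\<close> times the lift of \<open>Q\<close> the
          perturbation.\<close>
        have "mconst (eps ^ (N + 1)) = mconst (eps ^ N) * mconst (eps :: 'a poly fract)"
          by (simp add: mconst_def mult_single mult.commute)
        then have "(\<Sum>i=1..k n. mconst (c i) * esym (Suc ?p) (m i) (L i)) =
            mconst (eps ^ N) * (block_poly ?p (s n) + msmult eps (lift_poly Q))"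
          using eq by (simp add: lift_const_block_poly p msmult_def distrib_left mult.assoc)
        moreover have "eps ^ N \<noteq> (0 :: 'a poly fract)"
          by (simp add: eps_def)
        \<comment> \<open>Each coefficient is a polynomial multiple of \<epsilon>: the denominator
          is 1 and the numerator vanishes at 0.\<close>
        moreover have "lookup (msmult eps (lift_poly Q)) t \<in> m\<^sub>\<epsilon>" for t
          unfolding m\<^sub>\<epsilon>_def mem_Collect_eq lookup_msmult lift_poly_def
          by (intro exI[of _ "[:0, 1:] * lookup Q t"] exI[of _ 1])
             (simp add: lookup_map eps_def flip: to_fract_mult)
        moreover have "lookup (L i j) 0 = 0" if "i \<in> {1..k n}" "j \<in> {1..m i}" for i j
          using L that lookup_0_linear_form by blast
        ultimately have "2 ^ (?p * s n) \<le> ?p ^ (k n * ?p) * (2 ^ ?p - 1) ^ s n"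
          using prime[folded p] by (intro E.two_power_le_of_esym_sum)
        then have "2 ^ (p * s n) \<le> p ^ (k n * p) * (2 ^ p - 1) ^ s n"
          unfolding p .
        with gt show False by linarith
      qed
    qed
  qed
qed

end
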